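(* For all $n\ge1$ and $1\le k\le n$, the number of permutations of $[n]$ with $k$ cycles that cyclically avoid 1--3--2 equals the number of permutations of $[n]$ with $k$ cycles that cyclically avoid 1--2--3, equals the number of Dyck paths of semilength $n$ with $k$ peaks, equals the number of 1--3--2-avoiding permutations of $[n]$ (one-line notation) with $k-1$ descents, and equals the Narayana number \[\frac{1}{k}\binom{n-1}{k-1}\binom{n}{k-1}.\]
   Context: The standard cycle form writes each cycle starting with its smallest element, cycles listed in decreasing order of smallest elements; $\Psi(\pi)$ is the word obtained by deleting the parentheses. $\pi$ cyclically avoids the classical pattern $\sigma$ (here 1--3--2 or 1--2--3) if the word $\Psi(\pi)$ has no indices $i<j<k$ with $\Psi(\pi)_i\Psi(\pi)_j\Psi(\pi)_k$ order-isomorphic to $\sigma$. A Dyck path of semilength $n$ is a lattice path from $(0,0)$ to $(2n,0)$ with steps $(1,1)$ and $(1,-1)$ never going below the $x$-axis; a peak is an up step immediately followed by a down step. A descent of $\pi$ is an index $i$ with $\pi(i)>\pi(i+1)$. *)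

theory Defs
  imports Complex_Main "HOL-Combinatorics.Combinatorics" "HOL-Library.Product_Plus"
begin

definition order_isomorphic :: "nat list \<Rightarrow> nat list \<Rightarrow> bool" where
  "order_isomorphic u v \<longleftrightarrow> length u = length v \<and>
     (\<forall>a<length u. \<forall>b<length u. u ! a < u ! b \<longleftrightarrow> v ! a < v ! b)"

definition word_avoids :: "nat list \<Rightarrow> nat list \<Rightarrow> bool" where
  "word_avoids w \<sigma> \<longleftrightarrow> \<not> (\<exists>i j k. i < j \<and> j < k \<and> k < length w \<and>
     order_isomorphic [w ! i, w ! j, w ! k] \<sigma>)"

text \<open>A permutation of \<open>[n]\<close> is a function \<open>\<pi>\<close> with \<open>\<pi> permutes {1..n}\<close>, that is,
  a bijection of \<open>{1..n}\<close> extended by the identity. Its cycles are represented by their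
  underlying sets, the orbits; fixed points in \<open>{1..n}\<close> are cycles of length one.\<close>

definition cycle_sets :: "nat \<Rightarrow> (nat \<Rightarrow> nat) \<Rightarrow> nat set set" where
  "cycle_sets n \<pi> = orbit \<pi> ` {1..n}"

definition num_cycles :: "nat \<Rightarrow> (nat \<Rightarrow> nat) \<Rightarrow> nat" where
  "num_cycles n \<pi> = card (cycle_sets n \<pi>)"

text \<open>\<^term>\<open>support \<pi> m\<close> is the list \<open>[m, \<pi> m, \<pi> (\<pi> m), \<dots>]\<close> running once through the
  cycle of \<open>m\<close>.\<close>

definition standard_cycle_form :: "nat \<Rightarrow> (nat \<Rightarrow> nat) \<Rightarrow> nat list list" where
  "standard_cycle_form n \<pi> =
     map (support \<pi>) (rev (sorted_list_of_set (Min ` cycle_sets n \<pi>)))"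

definition Psi :: "nat \<Rightarrow> (nat \<Rightarrow> nat) \<Rightarrow> nat list" where
  "Psi n \<pi> = concat (standard_cycle_form n \<pi>)"

definition cyclically_avoids :: "nat \<Rightarrow> (nat \<Rightarrow> nat) \<Rightarrow> nat list \<Rightarrow> bool" where
  "cyclically_avoids n \<pi> \<sigma> \<longleftrightarrow> word_avoids (Psi n \<pi>) \<sigma>"

definition one_line :: "nat \<Rightarrow> (nat \<Rightarrow> nat) \<Rightarrow> nat list" where
  "one_line n \<pi> = map \<pi> [1..<Suc n]"

definition num_descents :: "nat \<Rightarrow> (nat \<Rightarrow> nat) \<Rightarrow> nat" where
  "num_descents n \<pi> = card {i. 1 \<le> i \<and> i < n \<and> \<pi> i > \<pi> (i + 1)}"

text \<open>A lattice path starting at the origin is the list of its steps, so the point reached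
  after \<open>i\<close> steps of \<open>p\<close> is \<open>sum_list (take i p)\<close>.\<close>

definition up_step :: "int \<times> int" where "up_step = (1, 1)"

definition down_step :: "int \<times> int" where "down_step = (1, -1)"

definition dyck_path :: "nat \<Rightarrow> (int \<times> int) list \<Rightarrow> bool" where
  "dyck_path n p \<longleftrightarrow> set p \<subseteq> {up_step, down_step} \<and> sum_list p = (2 * int n, 0) \<and>
     (\<forall>i\<le>length p. snd (sum_list (take i p)) \<ge> 0)"

definition num_peaks :: "(int \<times> int) list \<Rightarrow> nat" where
  "num_peaks p = card {i. i + 1 < length p \<and> p ! i = up_step \<and> p ! (i + 1) = down_step}"

end

theory Submission
  imports Defs
begin

text \<open>All objects in question grow along the same generating tree: a node with label \<open>l\<close> has one
  child of each label \<open>1, \<dots>, l + 1\<close>, and a weight increases by one along every edge except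
  the one to the child with label \<open>l + 1\<close>. The number of nodes of given level, weight and minimal
  label satisfies a linear recurrence that is solved by a \<open>2 \<times> 2\<close> determinant of binomial
  coefficients; the nodes with given level and weight are therefore counted by Narayana numbers.

  A word avoiding 1--3--2 receives a new least letter within or next to its final increasing run
  (label: length of that run; weight: descents). A word avoiding 1--2--3 receives a new greatest
  letter within or next to its initial decreasing run (label: length of that run; weight: letters
  that are not left-to-right minima). A Dyck path receives a new peak on its last descent (label: length of that descent;
  weight: peaks minus one). For 1--2--3 the symmetry of the Narayana numbers converts the weight
  into the number of left-to-right minima.

  Cycles of a permutation correspond to the left-to-right minima of its standard cycle form, and in
  a nonempty word avoiding 1--3--2 there is one more left-to-right minimum than there are descents.\<close>

section \<open>A generating tree for the Narayana numbers\<close>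

text \<open>\<open>child j\<close> yields the child with label \<open>Suc j\<close>, so
  \<open>j\<close> starts at 0. Positive labels together with the bijections onto the label classes
  give every node of level \<open>Suc n\<close> exactly one parent.\<close>

locale narayana_tree =
  fixes C :: "nat \<Rightarrow> 'a set" and label weight :: "'a \<Rightarrow> nat" and child :: "nat \<Rightarrow> 'a \<Rightarrow> 'a"
    and root :: 'a
  assumes level_0: "C 0 = {root}" and label_root: "label root = 0" and weight_root: "weight root = 0"
    and label_pos: "w \<in> C (Suc n) \<Longrightarrow> 0 < label w"
    and child_bij: "bij_betw (child j) {u \<in> C n. j \<le> label u} {w \<in> C (Suc n). label w = Suc j}"
    and weight_child: "u \<in> C n \<Longrightarrow> j \<le> label u \<Longrightarrow>
      weight (child j u) = weight u + (if j < label u then 1 else 0)"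
begin

lemma label_le: "u \<in> C n \<Longrightarrow> label u \<le> n"
proof (induction n arbitrary: u)
  case 0
  then show ?case by (simp add: level_0 label_root)
next
  case (Suc n)
  obtain j where j: "label u = Suc j" using label_pos[OF Suc.prems] gr0_implies_Suc by blast
  then obtain v where "v \<in> C n" "j \<le> label v"
    using child_bij[of j n] Suc.prems by (force simp: bij_betw_def)
  then show ?case using Suc.IH j by fastforce
qed

text \<open>Only finitely many labels occur on a level, and each label class is in bijection with
  part of the previous level. Finiteness makes \<open>card\<close> additive in the counts
  below.\<close>

lemma finite_level: "finite (C n)"
proof (induction n)
  case 0
  then show ?case by (simp add: level_0)
next
  case (Suc n)
  have "finite {w \<in> C (Suc n). label w = Suc j}" for j
    using bij_betw_finite[OF child_bij[of j n]] Suc by simp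
  moreover have "C (Suc n) \<subseteq> (\<Union>j\<le>n. {w \<in> C (Suc n). label w = Suc j})"
    using label_pos label_le by (fastforce dest: gr0_implies_Suc)
  ultimately show ?case by (meson finite_UN_I finite_atMost finite_subset)
qed

section \<open>Counting nodes by level, weight and label\<close>

definition count_eq :: "nat \<Rightarrow> nat \<Rightarrow> nat \<Rightarrow> nat" where
  "count_eq n x j = card {u \<in> C n. weight u = x \<and> label u = j}"

text \<open>Tail counts enter because a child with label \<open>Suc j\<close> may have any parent
  with label at least \<open>j\<close>.\<close>

definition count_ge :: "nat \<Rightarrow> nat \<Rightarrow> nat \<Rightarrow> nat" where
  "count_ge n x j = card {u \<in> C n. weight u = x \<and> j \<le> label u}"

lemma count_ge_split: "count_ge n x j = count_eq n x j + count_ge n x (Suc j)"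
proof -
  have "{u \<in> C n. weight u = x \<and> j \<le> label u} =
      {u \<in> C n. weight u = x \<and> label u = j} \<union> {u \<in> C n. weight u = x \<and> Suc j \<le> label u}"
    by auto
  then show ?thesis unfolding count_eq_def count_ge_def
    by (simp add: card_Un_disjoint finite_level disjoint_iff)
qed

lemma count_ge_eq_0: "n < j \<Longrightarrow> count_ge n x j = 0"
  unfolding count_ge_def using label_le by (fastforce simp: card_eq_0_iff)

lemma count_eq_0: "count_eq (Suc n) x 0 = 0"
  unfolding count_eq_def using label_pos by (fastforce simp: card_eq_0_iff)

text \<open>The parent of a node with label \<open>Suc j\<close> has label \<open>j\<close>, and
  then the weight is kept, or a larger label, and then the weight has just risen by one.\<close>

lemma count_eq_Suc:
  "count_eq (Suc n) x (Suc j) = count_eq n x j + (case x of 0 \<Rightarrow> 0 | Suc y \<Rightarrow> count_ge n y (Suc j))"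
proof -
  define S where "S = {u \<in> C n. j \<le> label u \<and> weight (child j u) = x}"
  have "bij_betw (child j) S {w \<in> C (Suc n). weight w = x \<and> label w = Suc j}"
  proof (rule bij_betw_subset[OF child_bij[of j n]])
    have "w \<in> child j ` S" if "w \<in> C (Suc n)" "weight w = x" "label w = Suc j" for w
      using that bij_betw_imp_surj_on[OF child_bij[of j n]] by (force simp: S_def)
    moreover have "child j u \<in> C (Suc n) \<and> label (child j u) = Suc j" if "u \<in> S" for u
      using that bij_betw_apply[OF child_bij[of j n], of u] by (simp add: S_def)
    ultimately show "child j ` S = {w \<in> C (Suc n). weight w = x \<and> label w = Suc j}"
      by (auto simp: S_def)
  qed (auto simp: S_def)
  then have "count_eq (Suc n) x (Suc j) = card S"
    by (simp add: bij_betw_same_card count_eq_def)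
  also have "S = {u \<in> C n. weight u = x \<and> label u = j} \<union>
      {u \<in> C n. Suc (weight u) = x \<and> Suc j \<le> label u}"
    unfolding S_def using weight_child by (auto split: if_splits)
  also have "card \<dots> = count_eq n x j + card {u \<in> C n. Suc (weight u) = x \<and> Suc j \<le> label u}"
    unfolding count_eq_def by (simp add: card_Un_disjoint finite_level disjoint_iff)
  finally show ?thesis by (auto simp: count_ge_def split: nat.split)
qed

text \<open>The closed form is the Lindstroem--Gessel--Viennot determinant for the pairs of
  non-crossing lattice paths that encode a Dyck path.\<close>

lemma count_ge_closed:
  assumes "d \<le> n"
  shows "int (count_ge (Suc n) x (Suc d)) =
    int (n choose x) * int ((n - d) choose x) -
    (case x of 0 \<Rightarrow> 0 | Suc y \<Rightarrow> int (n choose y)) * int ((n - d) choose Suc x)"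
  using assms
proof (induction n arbitrary: x d)
  case 0
  have "count_eq 0 x 0 = (if x = 0 then 1 else 0)"
    by (auto simp: count_eq_def level_0 label_root weight_root card_1_singleton_iff intro!: exI[of _ root])
  then have "count_ge (Suc 0) x (Suc 0) = (if x = 0 then 1 else 0)"
    by (auto simp: count_ge_split[of "Suc 0" x "Suc 0"] count_ge_eq_0 count_eq_Suc split: nat.split)
  then show ?case using 0 by (simp split: nat.split)
next
  case (Suc n)
  have IH: "int (count_ge (Suc n) x (Suc d)) =
    int (n choose x) * int ((n - d) choose x) -
    (case x of 0 \<Rightarrow> 0 | Suc y \<Rightarrow> int (n choose y)) * int ((n - d) choose Suc x)" if "d \<le> n" for x d
    using Suc.IH that by blast
  show ?case using Suc.prems
  \<comment> \<open>The inner induction descends in \<open>d\<close> from \<open>Suc n\<close>: each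
    step adds one label to the tail, and the recurrence evaluates that label on the previous
    level.\<close>
  proof (induction rule: inc_induct)
    case base
    \<comment> \<open>Both tails consist of the maximal label alone, and a node with maximal label
      has a parent with maximal label and the same weight.\<close>
    have "count_ge (Suc (Suc n)) x (Suc (Suc n)) = count_ge (Suc n) x (Suc n)"
      using count_ge_split[of "Suc (Suc n)" x "Suc (Suc n)"] count_ge_split[of "Suc n" x "Suc n"]
      by (simp add: count_eq_Suc count_ge_eq_0 split: nat.split)
    then show ?case by (cases x) (simp_all add: IH)
  next
    case (step d)
    then obtain m where m: "n = d + m" using less_Suc_eq_le nat_le_iff_add by blast
    \<comment> \<open>Pascal's rule applied to the difference of two neighbouring tails. The factor
      \<open>if x = 0\<close> encodes a vanishing binomial with lower index -1; at
      \<open>d = 0\<close> everything cancels, in accordance with \<open>count_eq_0\<close>.\<close>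
    have eq: "int (count_eq (Suc n) x d) =
        int (n choose x) * int ((n - d) choose (case x of 0 \<Rightarrow> 0 | Suc y \<Rightarrow> y)) * (if x = 0 then 0 else 1)
        - (case x of 0 \<Rightarrow> 0 | Suc y \<Rightarrow> int (n choose y)) * int ((n - d) choose x)"
    proof (cases d)
      case 0
      then show ?thesis by (simp add: count_eq_0 split: nat.split)
    next
      case (Suc d')
      then have "int (count_eq (Suc n) x d) =
          int (count_ge (Suc n) x (Suc d')) - int (count_ge (Suc n) x (Suc d))"
        using count_ge_split[of "Suc n" x d] by simp
      moreover have "n - d' = Suc m" "n - d = m" using Suc m by simp_all
      moreover have "d' \<le> n" "d \<le> n" using Suc m by simp_all
      ultimately show ?thesis
        using IH[of d' x] IH[of d x] Suc by (cases x) (simp_all add: algebra_simps)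
    qed
    have split: "int (count_ge (Suc (Suc n)) x (Suc d)) = int (count_eq (Suc n) x d)
        + (case x of 0 \<Rightarrow> 0 | Suc y \<Rightarrow> int (count_ge (Suc n) y (Suc d)))
        + int (count_ge (Suc (Suc n)) x (Suc (Suc d)))"
      using count_ge_split[of "Suc (Suc n)" x "Suc d"] by (simp add: count_eq_Suc split: nat.split)
    have nd: "Suc n - d = Suc m" "Suc n - Suc d = m" "n - d = m" and "d \<le> n" using m by auto
    show ?case
    proof (cases x)
      case (Suc y)
      \<comment> \<open>All binomials are brought to the rows \<open>n\<close> and \<open>m\<close>
        by Pascal's rule; the inner hypothesis supplies the shorter tail, the outer one the tail of
        weight \<open>y\<close>.\<close>
      with \<open>d \<le> n\<close> show ?thesis
        using split step.IH eq IH[of d y] unfolding Suc nd by (cases y) (simp_all add: algebra_simps)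
    qed (use split step.IH eq in simp)
  qed
qed

text \<open>Positive labels make this the full tail, the closed form at \<open>d = 0\<close>. Its
  determinant is the Narayana number of \<open>Suc n\<close> with parameter
  \<open>Suc x\<close>.\<close>

lemma card_weight:
  "real (card {u \<in> C (Suc n). weight u = x}) = real (n choose x) * real (Suc n choose x) / real (Suc x)"
proof -
  have "{u \<in> C (Suc n). weight u = x} = {u \<in> C (Suc n). weight u = x \<and> Suc 0 \<le> label u}"
    using label_pos by (auto simp: Suc_le_eq)
  then have "real (card {u \<in> C (Suc n). weight u = x}) = real_of_int (int (count_ge (Suc n) x (Suc 0)))"
    by (simp add: count_ge_def)
  also have "\<dots> = real (n choose x) * real (n choose x) -
    (case x of 0 \<Rightarrow> 0 | Suc y \<Rightarrow> real (n choose y)) * real (n choose Suc x)"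
    by (simp add: count_ge_closed split: nat.split)
  also have "\<dots> = real (n choose x) * real (Suc n choose x) / real (Suc x)"
  proof (cases x)
    case (Suc y)
    show ?thesis
    proof (cases "x \<le> n")
      case True
      then obtain m where m: "n = x + m" using nat_le_iff_add by blast
      \<comment> \<open>With \<open>m = n - x\<close>, absorption expresses both neighbours of
        \<open>n choose x\<close> in row \<open>n\<close> through it.\<close>
      have 1: "real (Suc x) * real (n choose Suc x) = real m * real (n choose x)"
        using binomial_absorption[of x n] binomial_absorb_comp[of n x] m
        by (metis add_diff_cancel_left' of_nat_mult)
      have 2: "real x * real (n choose x) = real (Suc m) * real (n choose y)"
        using binomial_absorption[of y n] binomial_absorb_comp[of n y] m Suc
        by (metis add_Suc_right add_Suc_shift add_diff_cancel_left' of_nat_mult)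
      have "(real (n choose x))\<^sup>2 * real (Suc x) - (real (Suc x) * real (n choose Suc x)) * real (n choose y)
         = real (n choose x) * (real (n choose x) * real (Suc x) - real m * real (n choose y))"
        unfolding 1 by (simp add: algebra_simps power2_eq_square)
      also have "real (n choose x) * real (Suc x) - real m * real (n choose y) = real (Suc n choose x)"
        using 2 Suc by (simp add: algebra_simps)
      finally show ?thesis using Suc by (simp add: field_simps power2_eq_square)
    qed (use Suc in \<open>simp add: binomial_eq_0\<close>)
  qed simp
  finally show ?thesis .
qed

end

section \<open>Words\<close>

text \<open>\<open>sorted_wrt\<close> ranges over all pairs of positions in order, so fixing the
  head as first letter of an occurrence gives a recursion suited to induction on words. The ternary
  relation serves both patterns.\<close>

fun avoids3 :: "('a \<Rightarrow> 'a \<Rightarrow> 'a \<Rightarrow> bool) \<Rightarrow> 'a list \<Rightarrow> bool" where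
  "avoids3 R [] = True"
| "avoids3 R (x # xs) = (sorted_wrt (\<lambda>y z. \<not> R x y z) xs \<and> avoids3 R xs)"

lemma avoids3_iff_nth:
  "avoids3 R w \<longleftrightarrow> \<not> (\<exists>i j k. i < j \<and> j < k \<and> k < length w \<and> R (w ! i) (w ! j) (w ! k))"
proof (induction w)
  case (Cons x xs)
  have "(\<exists>i j k. i < j \<and> j < k \<and> k < length (x # xs) \<and> R ((x # xs) ! i) ((x # xs) ! j) ((x # xs) ! k)) \<longleftrightarrow>
      (\<exists>j k. j < k \<and> k < length xs \<and> R x (xs ! j) (xs ! k)) \<or>
      (\<exists>i j k. i < j \<and> j < k \<and> k < length xs \<and> R (xs ! i) (xs ! j) (xs ! k))" (is "?L \<longleftrightarrow> ?A \<or> ?B")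
  proof
    assume ?L
    then obtain i j k where *: "i < j" "j < k" "k < length (x # xs)"
      "R ((x # xs) ! i) ((x # xs) ! j) ((x # xs) ! k)" by blast
    then obtain j' k' where "j = Suc j'" "k = Suc k'" by (metis Nat.lessE)
    then show "?A \<or> ?B" using * by (cases i) auto
  next
    assume "?A \<or> ?B"
    then show ?L
    proof
      assume ?A
      then obtain j k where "j < k" "k < length xs" "R x (xs ! j) (xs ! k)" by blast
      then show ?L by (intro exI[of _ 0] exI[of _ "Suc j"] exI[of _ "Suc k"]) simp
    next
      assume ?B
      then obtain i j k where "i < j" "j < k" "k < length xs" "R (xs ! i) (xs ! j) (xs ! k)" by blast
      then show ?L by (intro exI[of _ "Suc i"] exI[of _ "Suc j"] exI[of _ "Suc k"]) simp
    qed
  qed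
  then show ?case using Cons by (auto simp: sorted_wrt_iff_nth_less)
qed simp

abbreviation avoids_132 :: "nat list \<Rightarrow> bool" where
  "avoids_132 \<equiv> avoids3 (\<lambda>x y z. x < z \<and> z < y)"

abbreviation avoids_123 :: "nat list \<Rightarrow> bool" where
  "avoids_123 \<equiv> avoids3 (\<lambda>x y z. x < y \<and> y < z)"

lemma word_avoids_132: "word_avoids w [1, 3, 2] \<longleftrightarrow> avoids_132 w"
proof -
  have "order_isomorphic [x, y, z] [1, 3, 2] \<longleftrightarrow> x < z \<and> z < y" for x y z
    unfolding order_isomorphic_def by (simp add: All_less_Suc numeral_3_eq_3) linarith
  then show ?thesis by (simp add: word_avoids_def avoids3_iff_nth)
qed

lemma word_avoids_123: "word_avoids w [1, 2, 3] \<longleftrightarrow> avoids_123 w"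
proof -
  have "order_isomorphic [x, y, z] [1, 2, 3] \<longleftrightarrow> x < y \<and> y < z" for x y z
    unfolding order_isomorphic_def by (simp add: All_less_Suc numeral_3_eq_3) linarith
  then show ?thesis by (simp add: word_avoids_def avoids3_iff_nth)
qed

text \<open>A strictly least letter can only play the 1, so it creates an occurrence exactly when a
  strictly decreasing pair follows it.\<close>

lemma avoids_132_insert_min:
  "\<forall>x\<in>set (A @ B). m < x \<Longrightarrow> avoids_132 (A @ m # B) \<longleftrightarrow> avoids_132 (A @ B) \<and> sorted B"
proof (induction A)
  case Nil
  then have "sorted_wrt (\<lambda>y z. \<not> (m < z \<and> z < y)) B \<longleftrightarrow> sorted B"
    by (auto simp: sorted_wrt_iff_nth_less not_less) (meson leD nth_mem)
  then show ?case by auto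
qed (auto simp: sorted_wrt_append)

text \<open>A strictly greatest letter can only play the 3, so it creates an occurrence exactly when
  a strictly increasing pair precedes it.\<close>

lemma avoids_123_insert_max:
  "\<forall>x\<in>set (A @ B). x < m \<Longrightarrow> avoids_123 (A @ m # B) \<longleftrightarrow> avoids_123 (A @ B) \<and> sorted_wrt (\<ge>) A"
proof (induction A)
  case Nil
  then have "sorted_wrt (\<lambda>y z. \<not> (m < y \<and> y < z)) B"
    by (auto simp: sorted_wrt_iff_nth_less) (meson less_trans not_less_iff_gr_or_eq nth_mem)
  then show ?case by auto
next
  case (Cons x A)
  have "(\<forall>y\<in>set A. \<not> (x < y \<and> y < m)) \<longleftrightarrow> (\<forall>y\<in>set A. y \<le> x)"
    using Cons.prems by auto
  moreover have "\<forall>y\<in>set B. \<not> (x < m \<and> m < y)" using Cons.prems by (metis Un_iff less_asym set_append append_Cons list.set_intros(2))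
  ultimately show ?case using Cons by (auto simp: sorted_wrt_append)
qed

lemma avoids_132_map_Suc: "avoids_132 (map Suc w) \<longleftrightarrow> avoids_132 w"
  by (induction w) (simp_all add: sorted_wrt_map)

section \<open>Word statistics: adjacent pairs, left-to-right minima, initial runs\<close>

fun count_adj :: "('a \<Rightarrow> 'a \<Rightarrow> bool) \<Rightarrow> 'a list \<Rightarrow> nat" where
  "count_adj R (x # y # zs) = (if R x y then 1 else 0) + count_adj R (y # zs)"
| "count_adj R _ = 0"

text \<open>The last summand is the pair straddling the junction. The relation stays generic so that
  descents of words and peaks of paths are both covered.\<close>

lemma count_adj_append:
  "count_adj R (xs @ ys) = count_adj R xs + count_adj R ys +
    (if xs \<noteq> [] \<and> ys \<noteq> [] \<and> R (last xs) (hd ys) then 1 else 0)"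
proof (induction R xs rule: count_adj.induct)
  case ("2_2" R x)
  then show ?case by (cases ys) auto
qed auto

lemma count_adj_map_Suc: "count_adj (>) (map Suc xs) = count_adj (>) xs"
  by (induction "(>) :: nat \<Rightarrow> nat \<Rightarrow> bool" xs rule: count_adj.induct) auto

lemma count_adj_eq_card:
  "count_adj R xs = card {i. Suc i < length xs \<and> R (xs ! i) (xs ! Suc i)}"
proof (induction R xs rule: count_adj.induct)
  case (1 R x y zs)
  have "{i. Suc i < length (x # y # zs) \<and> R ((x # y # zs) ! i) ((x # y # zs) ! Suc i)} =
     (if R x y then {0} else {}) \<union> Suc ` {i. Suc i < length (y # zs) \<and> R ((y # zs) ! i) ((y # zs) ! Suc i)}"
    (is "?S = ?Z \<union> Suc ` ?T")
  proof (rule set_eqI)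
    show "i \<in> ?S \<longleftrightarrow> i \<in> ?Z \<union> Suc ` ?T" for i by (cases i) (auto simp: image_iff)
  qed
  also have "card \<dots> = card ?Z + card ?T"
    by (subst card_Un_disjoint) (auto simp: card_image)
  finally show ?case using 1 by simp
qed auto

text \<open>A later letter is a left-to-right minimum exactly when it is one among the letters below
  the head, hence the filter.\<close>

fun num_lr_minima :: "nat list \<Rightarrow> nat" where
  "num_lr_minima [] = 0"
| "num_lr_minima (x # xs) = Suc (num_lr_minima (filter (\<lambda>y. y < x) xs))"

lemma num_lr_minima_le_length: "num_lr_minima w \<le> length w"
proof (induction w rule: num_lr_minima.induct)
  case (2 x xs)
  then have "num_lr_minima (filter (\<lambda>y. y < x) xs) \<le> length xs"
    using length_filter_le by (rule le_trans)
  then show ?case by simp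
qed simp

lemma num_lr_minima_insert_max:
  assumes "\<forall>x\<in>set (A @ B). x < m"
  shows "num_lr_minima (A @ m # B) = num_lr_minima (A @ B) + (if A = [] then 1 else 0)"
proof (cases A)
  case Nil
  then have "filter (\<lambda>y. y < m) B = B" using assms by (simp add: filter_id_conv)
  then show ?thesis using Nil by simp
next
  case (Cons x A')
  then have "\<not> m < x" using assms by auto
  then show ?thesis using Cons by simp
qed

text \<open>The least letter passes every filter before it and then filters out everything after
  it.\<close>

lemma num_lr_minima_append_min:
  assumes "\<forall>x\<in>set A. m < x" and "\<forall>x\<in>set B. m < x"
  shows "num_lr_minima (A @ m # B) = Suc (num_lr_minima A)"
  using assms
proof (induction A arbitrary: B rule: num_lr_minima.induct)
  case 1
  then have "filter (\<lambda>y. y < m) B = []" by (auto simp: filter_empty_conv)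
  then show ?case by simp
qed auto

text \<open>In a word avoiding 1--3--2, every descent bottom is a left-to-right minimum.\<close>

lemma num_lr_minima_eq_descents:
  "w \<noteq> [] \<Longrightarrow> distinct w \<Longrightarrow> avoids_132 w \<Longrightarrow> num_lr_minima w = Suc (count_adj (>) w)"
proof (induction "(>) :: nat \<Rightarrow> nat \<Rightarrow> bool" w rule: count_adj.induct)
  case (1 x y zs)
  show ?case
  proof (cases "y < x")
    case True
    then have "filter (\<lambda>z. z < y) (filter (\<lambda>z. z < x) zs) = filter (\<lambda>z. z < y) zs"
      by (auto intro: filter_cong)
    then show ?thesis using 1 True by simp
  next
    case False
    \<comment> \<open>A later letter strictly between \<open>x\<close> and \<open>y\<close> would
      complete a 1--3--2, and \<open>x\<close> does not recur.\<close>
    have "filter (\<lambda>z. z < x) zs = filter (\<lambda>z. z < y) zs"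
      using 1 False by (intro filter_cong) (auto simp: not_less le_less)
    then show ?thesis using 1 False by simp
  qed
qed auto

text \<open>Used directly as the label for 1--2--3 and through \<open>rev\<close>, as the length of
  the final increasing run, for 1--3--2. Weak and strict decrease agree on distinct letters.\<close>

fun decreasing_run :: "nat list \<Rightarrow> nat" where
  "decreasing_run [] = 0"
| "decreasing_run [x] = 1"
| "decreasing_run (x # y # zs) = (if y \<le> x then Suc (decreasing_run (y # zs)) else 1)"

text \<open>Translates the bound on \<open>j\<close> by the label into sortedness of a prefix, the
  condition appearing in the insertion lemmas.\<close>

lemma length_le_decreasing_run: "length A \<le> decreasing_run (A @ B) \<longleftrightarrow> sorted_wrt (\<ge>) A"
proof (induction A)
  case (Cons x A)
  then show ?case
  proof (cases A)
    case Nil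
    then show ?thesis by (cases B) auto
  next
    case (Cons y A')
    then show ?thesis using Cons.IH by (auto intro: order_trans)
  qed
qed simp

lemma decreasing_run_le_length: "decreasing_run w \<le> length w"
  by (induction w rule: decreasing_run.induct) auto

lemma decreasing_run_append:
  "sorted_wrt (\<ge>) (A @ [a]) \<Longrightarrow> B = [] \<or> a < hd B \<Longrightarrow> decreasing_run (A @ a # B) = Suc (length A)"
proof (induction A)
  case Nil
  then show ?case by (cases B) auto
next
  case (Cons x A)
  then show ?case by (cases A) auto
qed

lemma decreasing_run_Cons_max: "\<forall>x\<in>set w. x < m \<Longrightarrow> decreasing_run (m # w) = Suc (decreasing_run w)"
  by (cases w) auto

section \<open>Permutation words avoiding 1--3--2 and 1--2--3\<close>

lemma permutations_of_set_not_0: "(u :: nat list) \<in> permutations_of_set {1..n} \<Longrightarrow> 0 \<notin> set u"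
  by (auto simp: permutations_of_set_def)

lemma permutations_of_set_less_Suc: "(u :: nat list) \<in> permutations_of_set {1..n} \<Longrightarrow> \<forall>x\<in>set u. x < Suc n"
  by (simp add: permutations_of_set_def)

lemma permutations_of_set_1_Suc_split:
  assumes "w \<in> permutations_of_set {1..Suc n}"
  obtains A B where "w = map Suc A @ 1 # map Suc B" "A @ B \<in> permutations_of_set {1..n}"
proof -
  have w: "set w = {1..Suc n}" "distinct w" using assms by (auto dest: permutations_of_setD)
  then obtain A B where AB: "w = A @ 1 # B" by (metis atLeastAtMost_iff le_add1 plus_1_eq_Suc split_list order_refl)
  define A' B' where "A' = map (\<lambda>x. x - 1) A" "B' = map (\<lambda>x. x - 1) B"
  have "0 \<notin> set w" using w(1) by simp
  then have "\<forall>x\<in>set (A @ B). Suc (x - 1) = x" using AB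
    by (metis Suc_diff_1 Un_iff gr0I list.set_intros(2) set_append)
  then have eq: "map Suc A' = A" "map Suc B' = B"
    by (auto simp: A'_B'_def intro!: map_idI)
  have "Suc ` set (A' @ B') = set (map Suc A') \<union> set (map Suc B')" by (simp add: image_Un)
  also have "\<dots> = set w - {1}" using w(2) AB unfolding eq by auto
  also have "\<dots> = Suc ` {1..n}" unfolding w(1) image_Suc_atLeastAtMost by auto
  finally have "set (A' @ B') = {1..n}" by (simp only: inj_image_eq_iff inj_Suc)
  moreover have "distinct (map Suc (A' @ B'))" using w(2) AB eq by simp
  then have "distinct (A' @ B')" using distinct_map by blast
  ultimately have "A' @ B' \<in> permutations_of_set {1..n}" by blast
  then show thesis using that AB eq by blast
qed

lemma insert_min_permutations_of_set:
  assumes "A @ B \<in> permutations_of_set {1..n}"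
  shows "map Suc A @ 1 # map Suc B \<in> permutations_of_set {1..Suc n}"
proof (rule permutations_of_setI)
  have u: "set (A @ B) = {1..n}" "distinct (A @ B)" using permutations_of_setD[OF assms] by blast+
  have "set (map Suc A @ 1 # map Suc B) = insert 1 (Suc ` set (A @ B))" by auto
  also have "\<dots> = {1..Suc n}" unfolding u(1) by (auto simp: image_Suc_atLeastAtMost)
  finally show "set (map Suc A @ 1 # map Suc B) = {1..Suc n}" .
  have "distinct (map Suc (A @ B))" "0 \<notin> set (A @ B)"
    using u permutations_of_set_not_0[OF assms] by (simp_all only: distinct_map) auto
  then show "distinct (map Suc A @ 1 # map Suc B)" by (auto simp: image_iff)
qed

text \<open>The old letters move up to make room for 1, and \<open>j\<close> counts the letters to
  its right; the new final run is 1 followed by these.\<close>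

definition insert_min :: "nat \<Rightarrow> nat list \<Rightarrow> nat list" where
  "insert_min j u = map Suc (take (length u - j) u) @ 1 # map Suc (drop (length u - j) u)"

definition remove_min :: "nat list \<Rightarrow> nat list" where
  "remove_min w = map (\<lambda>x. x - 1) (removeAll 1 w)"

lemma remove_min_eq:
  assumes "A @ B \<in> permutations_of_set {1..n}"
  shows "remove_min (map Suc A @ 1 # map Suc B) = A @ B"
proof -
  have "0 \<notin> set A" "0 \<notin> set B" using permutations_of_set_not_0[OF assms] by simp_all
  then have "removeAll 1 (map Suc A) = map Suc A" "removeAll 1 (map Suc B) = map Suc B"
    by (auto intro!: removeAll_id)
  then show ?thesis by (simp add: remove_min_def comp_def)
qed

lemma insert_min_append: "length B = j \<Longrightarrow> insert_min j (A @ B) = map Suc A @ 1 # map Suc B"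
  by (auto simp: insert_min_def)

lemma sorted_iff_decreasing_run_rev: "sorted B \<longleftrightarrow> length B \<le> decreasing_run (rev (A @ B))"
  using length_le_decreasing_run[of "rev B" "rev A"] by (simp add: sorted_wrt_rev)

text \<open>Any letter just before the 1 is larger, so the final increasing run starts exactly at
  the 1.\<close>

lemma decreasing_run_rev_insert_min:
  assumes "A @ B \<in> permutations_of_set {1..n}" and "sorted B"
  shows "decreasing_run (rev (map Suc A @ 1 # map Suc B)) = Suc (length B)"
proof -
  have "0 \<notin> set A" using permutations_of_set_not_0[OF assms(1)] by simp
  then have "rev (map Suc A) = [] \<or> 1 < hd (rev (map Suc A))"
    by (cases A rule: rev_cases) auto
  moreover have "sorted_wrt (\<ge>) (rev (map Suc B) @ [1])"
    using assms(2) by (auto simp: sorted_wrt_append sorted_wrt_rev sorted_wrt_map)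
  ultimately show ?thesis using decreasing_run_append[of "rev (map Suc B)" 1 "rev (map Suc A)"] by simp
qed

text \<open>The 1 makes a descent with the letter before it and none with the letter after it. The
  count stays the same only if it splits an old descent or stands first; both mean that
  \<open>B\<close> is the whole final run.\<close>

lemma descents_insert_min:
  assumes "A @ B \<in> permutations_of_set {1..n}" and "sorted B"
  shows "count_adj (>) (map Suc A @ 1 # map Suc B) =
    count_adj (>) (A @ B) + (if length B < decreasing_run (rev (A @ B)) then 1 else 0)"
proof -
  have "0 \<notin> set (A @ B)" using permutations_of_set_not_0[OF assms(1)] by simp
  then have 1: "count_adj (>) (1 # map Suc B) = count_adj (>) B"
    by (cases B) (auto simp: count_adj_map_Suc simp flip: list.map(2))
  show ?thesis
  proof (cases A rule: rev_cases)
    case Nil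
    then show ?thesis using 1 decreasing_run_le_length[of "rev B"] by simp
  next
    case (snoc A' a)
    have "length B < decreasing_run (rev (A @ B)) \<longleftrightarrow> sorted_wrt (\<ge>) (rev B @ [a])"
      using length_le_decreasing_run[of "rev B @ [a]" "rev A'"] snoc by (simp add: Suc_le_eq)
    also have "\<dots> \<longleftrightarrow> B = [] \<or> a \<le> hd B"
      using assms(2) by (cases B) (auto simp: sorted_wrt_append sorted_wrt_rev)
    finally have 2: "length B < decreasing_run (rev (A @ B)) \<longleftrightarrow> B = [] \<or> a \<le> hd B" .
    have "count_adj (>) (map Suc A @ 1 # map Suc B) = Suc (count_adj (>) A + count_adj (>) B)"
      using count_adj_append[of "(>)" "map Suc A" "1 # map Suc B"] count_adj_map_Suc[of A] 1 snoc \<open>0 \<notin> set (A @ B)\<close>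
      by simp
    moreover have "count_adj (>) (A @ B) =
        count_adj (>) A + count_adj (>) B + (if B \<noteq> [] \<and> hd B < a then 1 else 0)"
      using count_adj_append[of "(>)" A B] snoc by simp
    ultimately show ?thesis unfolding 2 by auto
  qed
qed

text \<open>Goals 4, 5 and 6 are positivity of labels, the child bijection and the weight
  rule.\<close>

interpretation tree_132: narayana_tree
  "\<lambda>n. {w \<in> permutations_of_set {1..n}. avoids_132 w}" "\<lambda>w. decreasing_run (rev w)" "count_adj (>)" insert_min "[]"
proof (unfold_locales, goal_cases)
  case (4 w n)
  then show ?case by (cases w rule: rev_cases; cases "rev (butlast w)") (auto dest: permutations_of_setD)
next
  case (5 j n)
  have split: "\<exists>A B. u = A @ B \<and> length B = j \<and> A @ B \<in> permutations_of_set {1..n} \<and>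
      avoids_132 (A @ B) \<and> sorted B"
    if "u \<in> {u \<in> {w \<in> permutations_of_set {1..n}. avoids_132 w}. j \<le> decreasing_run (rev u)}" for u
  proof -
    have "j \<le> length u" using that decreasing_run_le_length[of "rev u"] by simp
    moreover from this have "sorted (drop (length u - j) u)"
      using that sorted_iff_decreasing_run_rev[of "drop (length u - j) u" "take (length u - j) u"] by simp
    ultimately show ?thesis using that
      by (intro exI[of _ "take (length u - j) u"] exI[of _ "drop (length u - j) u"]) simp
  qed
  have gt: "\<forall>x\<in>set (map Suc A @ map Suc B). 1 < x" if "A @ B \<in> permutations_of_set {1..n}" for A B :: "nat list"
    using permutations_of_setD(1)[OF that] by (auto simp: Suc_le_eq dest!: equalityD1)
  have av: "avoids_132 (map Suc A @ 1 # map Suc B) \<longleftrightarrow> avoids_132 (A @ B) \<and> sorted B"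
    if "A @ B \<in> permutations_of_set {1..n}" for A B
    using avoids_132_insert_min[OF gt[OF that]] avoids_132_map_Suc[of "A @ B"]
    by (simp add: sorted_map)
  show ?case
  proof (rule bij_betw_byWitness[where f' = remove_min])
    have out: "remove_min (insert_min j u) = u \<and> insert_min j u \<in> permutations_of_set {1..Suc n}
        \<and> avoids_132 (insert_min j u) \<and> decreasing_run (rev (insert_min j u)) = Suc j"
      if u: "u \<in> {u \<in> {w \<in> permutations_of_set {1..n}. avoids_132 w}. j \<le> decreasing_run (rev u)}" for u
    proof -
      obtain A B where AB: "u = A @ B" "length B = j" "A @ B \<in> permutations_of_set {1..n}"
        "avoids_132 (A @ B)" "sorted B" using split[OF u] by blast
      show ?thesis
        unfolding AB(1) insert_min_append[OF AB(2)] remove_min_eq[OF AB(3)]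
        using av[OF AB(3)] AB insert_min_permutations_of_set[OF AB(3)] decreasing_run_rev_insert_min[OF AB(3,5)]
        by blast
    qed
    then show "\<forall>u\<in>{u \<in> {w \<in> permutations_of_set {1..n}. avoids_132 w}. j \<le> decreasing_run (rev u)}.
        remove_min (insert_min j u) = u"
      and "insert_min j ` {u \<in> {w \<in> permutations_of_set {1..n}. avoids_132 w}. j \<le> decreasing_run (rev u)}
        \<subseteq> {w \<in> {w \<in> permutations_of_set {1..Suc n}. avoids_132 w}. decreasing_run (rev w) = Suc j}" by blast+
    have inv: "insert_min j (remove_min w) = w \<and> remove_min w \<in> permutations_of_set {1..n}
       \<and> avoids_132 (remove_min w) \<and> j \<le> decreasing_run (rev (remove_min w))"
      if w: "w \<in> permutations_of_set {1..Suc n}" "avoids_132 w" "decreasing_run (rev w) = Suc j" for w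
    proof -
      obtain A B where AB: "w = map Suc A @ 1 # map Suc B" "A @ B \<in> permutations_of_set {1..n}"
        using permutations_of_set_1_Suc_split[OF w(1)] by metis
      then have "avoids_132 (A @ B)" "sorted B" using av w(2) by auto
      \<comment> \<open>The label reveals where the 1 was inserted, so removing it loses no
        information.\<close>
      moreover from this have "length B = j" using decreasing_run_rev_insert_min[OF AB(2)] w(3) AB(1) by simp
      moreover have "j \<le> decreasing_run (rev (A @ B))" using calculation sorted_iff_decreasing_run_rev by blast
      ultimately show ?thesis
        using AB(2) insert_min_append[of B j A] remove_min_eq[OF AB(2)] by (simp only: AB(1) simp_thms)
    qed
    show "\<forall>w\<in>{w \<in> {w \<in> permutations_of_set {1..Suc n}. avoids_132 w}. decreasing_run (rev w) = Suc j}.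
      insert_min j (remove_min w) = w" using inv by blast
    show "remove_min ` {w \<in> {w \<in> permutations_of_set {1..Suc n}. avoids_132 w}. decreasing_run (rev w) = Suc j}
      \<subseteq> {u \<in> {w \<in> permutations_of_set {1..n}. avoids_132 w}. j \<le> decreasing_run (rev u)}" using inv by blast
  qed
next
  case (6 u n j)
  define A B where "A = take (length u - j) u" "B = drop (length u - j) u"
  have u: "u = A @ B" by (simp add: A_B_def)
  have "length B = j" using 6 decreasing_run_le_length[of "rev u"] by (simp add: A_B_def)
  moreover have "sorted B" using 6 calculation u sorted_iff_decreasing_run_rev by blast
  ultimately show ?case
    using descents_insert_min[of A B n] insert_min_append[of B j A] 6 u by simp
qed auto

section \<open>Inserting a new greatest letter: words avoiding 1--2--3\<close>

lemma permutations_of_set_Suc_split: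
  assumes "w \<in> permutations_of_set {1..Suc n}"
  obtains A B where "w = A @ Suc n # B" "A @ B \<in> permutations_of_set {1..n}"
proof -
  have w: "set w = {1..Suc n}" "distinct w" using assms by (auto dest: permutations_of_setD)
  then obtain A B where AB: "w = A @ Suc n # B"
    by (metis atLeastAtMost_iff le_add1 plus_1_eq_Suc split_list order_refl)
  then have "set (A @ B) = {1..Suc n} - {Suc n}" using w by auto
  also have "\<dots> = {1..n}" by auto
  finally have "A @ B \<in> permutations_of_set {1..n}" using AB w by (intro permutations_of_setI) auto
  then show thesis using that AB by blast
qed

lemma insert_max_permutations_of_set:
  assumes "A @ B \<in> permutations_of_set {1..n}"
  shows "A @ Suc n # B \<in> permutations_of_set {1..Suc n}"
proof (rule permutations_of_setI)
  have u: "set (A @ B) = {1..n}" "distinct (A @ B)" using permutations_of_setD[OF assms] by blast+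
  have "set (A @ Suc n # B) = insert (Suc n) (set (A @ B))" by auto
  also have "\<dots> = {1..Suc n}" unfolding u(1) by auto
  finally show "set (A @ Suc n # B) = {1..Suc n}" .
  show "distinct (A @ Suc n # B)"
    using u(2) permutations_of_set_less_Suc[OF assms] by (simp add: disjoint_iff) blast
qed

text \<open>Placed after \<open>Suc j\<close> letters of the initial run, the new letter cuts the
  run to length \<open>Suc j\<close>; placed in front, it lengthens the run by one. The front
  position therefore belongs to the largest index, \<open>j = decreasing_run u\<close>.\<close>

definition insert_max :: "nat \<Rightarrow> nat list \<Rightarrow> nat list" where
  "insert_max j u = (if j < decreasing_run u then take (Suc j) u @ Suc (length u) # drop (Suc j) u
    else Suc (length u) # u)"

text \<open>Unifies both placements as one splitting of \<open>u\<close>, with an empty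
  \<open>A\<close> marking the child with the largest label.\<close>

lemma insert_max_cases:
  assumes u: "u \<in> permutations_of_set {1..n}" and "j \<le> decreasing_run u"
  obtains A B where "u = A @ B" "insert_max j u = A @ Suc n # B" "sorted_wrt (\<ge>) A"
    "A = [] \<longleftrightarrow> j = decreasing_run u" "decreasing_run (A @ Suc n # B) = Suc j"
proof (cases "j < decreasing_run u")
  case True
  then have len: "Suc j \<le> length u" using decreasing_run_le_length[of u] by simp
  obtain A B where AB: "A = take (Suc j) u" "B = drop (Suc j) u" by blast
  have s: "sorted_wrt (\<ge>) A" using length_le_decreasing_run[of A B] True len AB by simp
  obtain A' a where A: "A = A' @ [a]" using AB len by (cases A rule: rev_cases) (simp, blast)
  have "a < Suc n" using permutations_of_set_less_Suc[OF u] AB A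
    by (metis append_take_drop_id in_set_conv_decomp_first set_append UnI1 append_is_Nil_conv in_set_conv_decomp)
  then have "decreasing_run (A @ Suc n # B) = Suc (length A')" using decreasing_run_append[of A' a "Suc n # B"] s A by simp
  moreover have "length A' = j" using A AB len by (metis length_append_singleton length_take min.absorb2 nat.inject)
  moreover have "length u = n" using length_finite_permutations_of_set[OF u] by simp
  ultimately show thesis using that[of A B] True s A AB(1) unfolding AB(2)
    by (metis append_is_Nil_conv append_take_drop_id insert_max_def length_append_singleton nat_neq_iff not_Cons_self2)
next
  case False
  then show thesis using that[of "[]" u] assms decreasing_run_Cons_max[OF permutations_of_set_less_Suc[OF u]]
      length_finite_permutations_of_set[OF u] by (simp add: insert_max_def)
qed

text \<open>The greatest letter is a left-to-right minimum only in front, which is the child with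
  the largest label. Counting the letters that are not minima thus leaves the weight unchanged on
  exactly that edge.\<close>

interpretation tree_123: narayana_tree
  "\<lambda>n. {w \<in> permutations_of_set {1..n}. avoids_123 w}" decreasing_run "\<lambda>w. length w - num_lr_minima w" insert_max "[]"
proof (unfold_locales, goal_cases)
  case (4 w n)
  then show ?case by (cases w; cases "tl w") (auto dest: permutations_of_setD)
next
  case (5 j n)
  show ?case
  proof (rule bij_betw_byWitness[where f' = "removeAll (Suc n)"])
    have out: "removeAll (Suc n) (insert_max j u) = u \<and> insert_max j u \<in> permutations_of_set {1..Suc n}
        \<and> avoids_123 (insert_max j u) \<and> decreasing_run (insert_max j u) = Suc j"
      if u: "u \<in> permutations_of_set {1..n}" "avoids_123 u" "j \<le> decreasing_run u" for u
    proof -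
      obtain A B where AB: "u = A @ B" "insert_max j u = A @ Suc n # B" "sorted_wrt (\<ge>) A"
        "decreasing_run (A @ Suc n # B) = Suc j" using insert_max_cases[OF u(1,3)] by metis
      have lt: "\<forall>x\<in>set (A @ B). x < Suc n" using permutations_of_set_less_Suc u(1) AB(1) by blast
      then have "removeAll (Suc n) (A @ Suc n # B) = A @ B" by (auto intro!: removeAll_id)
      then show ?thesis using AB u avoids_123_insert_max[OF lt] insert_max_permutations_of_set by simp
    qed
    then show "\<forall>u\<in>{u \<in> {w \<in> permutations_of_set {1..n}. avoids_123 w}. j \<le> decreasing_run u}.
        removeAll (Suc n) (insert_max j u) = u"
      and "insert_max j ` {u \<in> {w \<in> permutations_of_set {1..n}. avoids_123 w}. j \<le> decreasing_run u}
        \<subseteq> {w \<in> {w \<in> permutations_of_set {1..Suc n}. avoids_123 w}. decreasing_run w = Suc j}" by blast+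
    have inv: "insert_max j (removeAll (Suc n) w) = w \<and> removeAll (Suc n) w \<in> permutations_of_set {1..n}
       \<and> avoids_123 (removeAll (Suc n) w) \<and> j \<le> decreasing_run (removeAll (Suc n) w)"
      if w: "w \<in> permutations_of_set {1..Suc n}" "avoids_123 w" "decreasing_run w = Suc j" for w
    proof -
      obtain A B where AB: "w = A @ Suc n # B" "A @ B \<in> permutations_of_set {1..n}"
        using permutations_of_set_Suc_split[OF w(1)] by metis
      have lt: "\<forall>x\<in>set (A @ B). x < Suc n" using permutations_of_set_less_Suc AB(2) by blast
      then have rem: "removeAll (Suc n) w = A @ B" using AB(1) by (auto intro!: removeAll_id)
      have av: "avoids_123 (A @ B)" "sorted_wrt (\<ge>) A"
        using w(2) avoids_123_insert_max[OF lt] AB(1) by auto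
      have len: "length (A @ B) = n" using length_finite_permutations_of_set[OF AB(2)] by simp
      show ?thesis
      \<comment> \<open>If the greatest letter stands first, the parent has label exactly
        \<open>j\<close>; otherwise the run stops just before it, so \<open>Suc j\<close> letters
        precede it.\<close>
      proof (cases A rule: rev_cases)
        case Nil
        then have "decreasing_run (A @ B) = j" using w(3) AB(1) decreasing_run_Cons_max[of B "Suc n"] lt by simp
        then show ?thesis using rem av AB Nil len by (simp add: insert_max_def)
      next
        case (snoc A' a)
        then have "length A = Suc j" using decreasing_run_append[of A' a "Suc n # B"] av lt w(3) AB(1) by simp
        moreover have "length A \<le> decreasing_run (A @ B)" using length_le_decreasing_run av by blast
        ultimately show ?thesis using rem av AB len by (simp add: insert_max_def)
      qed
    qed
    show "\<forall>w\<in>{w \<in> {w \<in> permutations_of_set {1..Suc n}. avoids_123 w}. decreasing_run w = Suc j}.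
      insert_max j (removeAll (Suc n) w) = w" using inv by blast
    show "removeAll (Suc n) ` {w \<in> {w \<in> permutations_of_set {1..Suc n}. avoids_123 w}. decreasing_run w = Suc j}
      \<subseteq> {u \<in> {w \<in> permutations_of_set {1..n}. avoids_123 w}. j \<le> decreasing_run u}" using inv by blast
  qed
next
  case (6 u n j)
  then have u: "u \<in> permutations_of_set {1..n}" by simp
  obtain A B where AB: "u = A @ B" "insert_max j u = A @ Suc n # B" "A = [] \<longleftrightarrow> j = decreasing_run u"
    using insert_max_cases[OF u 6(2)] by metis
  have "\<forall>x\<in>set (A @ B). x < Suc n" using permutations_of_set_less_Suc[OF u] AB(1) by simp
  then have "num_lr_minima (insert_max j u) = num_lr_minima u + (if j = decreasing_run u then 1 else 0)"
    using num_lr_minima_insert_max[of A B "Suc n"] AB by simp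
  moreover have "length (insert_max j u) = Suc (length u)" unfolding AB(2) using AB(1) by simp
  ultimately show ?case using num_lr_minima_le_length[of u] 6(2) by simp
qed auto

section \<open>Dyck paths\<close>

text \<open>An arbitrary starting height makes the condition compatible with cutting a path in
  two.\<close>

fun nonneg_from :: "int \<Rightarrow> (int \<times> int) list \<Rightarrow> bool" where
  "nonneg_from h [] \<longleftrightarrow> 0 \<le> h"
| "nonneg_from h (s # p) \<longleftrightarrow> 0 \<le> h \<and> nonneg_from (h + snd s) p"

lemma nonneg_from_start: "nonneg_from h p \<Longrightarrow> 0 \<le> h"
  by (cases p) auto

lemma nonneg_from_append:
  "nonneg_from h (p @ q) \<longleftrightarrow> nonneg_from h p \<and> nonneg_from (h + snd (sum_list p)) q"
  by (induction p arbitrary: h) (auto simp: add.assoc dest: nonneg_from_start)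

lemma nonneg_from_end: "nonneg_from h p \<Longrightarrow> 0 \<le> h + snd (sum_list p)"
  using nonneg_from_append[of h p "[]"] by simp

lemma nonneg_from_iff_take: "nonneg_from h p \<longleftrightarrow> (\<forall>i\<le>length p. 0 \<le> h + snd (sum_list (take i p)))"
proof (induction p arbitrary: h)
  case (Cons s p)
  have "(\<forall>i\<le>length (s # p). 0 \<le> h + snd (sum_list (take i (s # p)))) \<longleftrightarrow>
      0 \<le> h \<and> (\<forall>i\<le>length p. 0 \<le> h + snd (sum_list (take (Suc i) (s # p))))"
    unfolding less_Suc_eq_le[symmetric] by (simp add: All_less_Suc2)
  then show ?case using Cons by (simp add: add.assoc)
qed simp

lemma nonneg_from_downs: "nonneg_from h (replicate j down_step) \<longleftrightarrow> int j \<le> h"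
  by (induction j arbitrary: h) (auto simp: down_step_def)

lemma up_neq_down: "up_step \<noteq> down_step" "down_step \<noteq> up_step"
  by (simp_all add: up_step_def down_step_def)

lemma sum_list_downs: "snd (sum_list (replicate j down_step)) = - int j"
  by (induction j) (auto simp: down_step_def)

lemma fst_sum_list_steps: "set p \<subseteq> {up_step, down_step} \<Longrightarrow> fst (sum_list p) = int (length p)"
  by (induction p) (auto simp: up_step_def down_step_def)

text \<open>Every step moves one unit to the right, so the horizontal end coordinate is the
  length.\<close>

lemma dyck_path_iff:
  "dyck_path n p \<longleftrightarrow> set p \<subseteq> {up_step, down_step} \<and> length p = 2 * n \<and>
    snd (sum_list p) = 0 \<and> nonneg_from 0 p"
  using fst_sum_list_steps[of p]
  by (auto simp: dyck_path_def nonneg_from_iff_take prod_eq_iff)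

text \<open>Final down steps that end at height 0 cannot go below the axis, so the height condition
  concerns only \<open>r\<close>.\<close>

lemma dyck_path_append_downs:
  "dyck_path n (r @ replicate j down_step) \<longleftrightarrow> set r \<subseteq> {up_step, down_step} \<and> length r + j = 2 * n \<and>
    snd (sum_list r) = int j \<and> nonneg_from 0 r"
  by (auto simp: dyck_path_iff nonneg_from_append nonneg_from_downs sum_list_downs)

text \<open>The new up step lifts the end of \<open>r\<close> from height \<open>j\<close> to
  \<open>Suc j\<close>, and the extra down step compensates for it.\<close>

lemma dyck_path_insert_peak:
  "dyck_path (Suc n) (r @ up_step # replicate (Suc j) down_step) \<longleftrightarrow>
    dyck_path n (r @ replicate j down_step)"
proof -
  have "dyck_path (Suc n) ((r @ [up_step]) @ replicate (Suc j) down_step) \<longleftrightarrow>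
    dyck_path n (r @ replicate j down_step)"
    unfolding dyck_path_append_downs using nonneg_from_end[of 0 r]
    by (auto simp: nonneg_from_append up_step_def)
  then show ?thesis by simp
qed

section \<open>Peaks and the last descent of a Dyck path\<close>

definition last_descent :: "(int \<times> int) list \<Rightarrow> nat" where
  "last_descent p = length (takeWhile (\<lambda>s. s = down_step) (rev p))"

lemma takeWhile_append_replicate:
  "takeWhile (\<lambda>s. s = x) (replicate j x @ xs) = replicate j x @ takeWhile (\<lambda>s. s = x) xs"
  by (induction j) auto

lemma last_descent_append_downs: "last_descent (r @ replicate j down_step) = j + last_descent r"
  by (simp add: last_descent_def takeWhile_append_replicate)

lemma last_descent_snoc: "last_descent (r @ [s]) = (if s = down_step then Suc (last_descent r) else 0)"
  by (simp add: last_descent_def)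

lemma last_descent_insert_peak: "last_descent (r @ up_step # replicate j down_step) = j"
  using last_descent_append_downs[of "r @ [up_step]" j] by (simp add: last_descent_snoc up_neq_down)

lemma last_descent_split:
  assumes "j \<le> last_descent p"
  obtains r where "p = r @ replicate j down_step"
proof -
  let ?L = "last_descent p"
  have "takeWhile (\<lambda>s. s = down_step) (rev p) = replicate ?L down_step"
    by (intro replicate_eqI) (auto simp: last_descent_def dest: set_takeWhileD)
  then have "rev p = replicate ?L down_step @ dropWhile (\<lambda>s. s = down_step) (rev p)"
    using takeWhile_dropWhile_id[of "\<lambda>s. s = down_step" "rev p"] by simp
  then have "p = rev (dropWhile (\<lambda>s. s = down_step) (rev p)) @ replicate ?L down_step"
    unfolding rev_swap by simp
  moreover have "replicate ?L down_step = replicate (?L - j) down_step @ replicate j down_step"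
    using assms by (simp flip: replicate_add)
  ultimately show thesis using that by (metis append.assoc)
qed

text \<open>A final up step reaching height 0 would start below the axis.\<close>

lemma dyck_path_last_descent_pos:
  assumes "dyck_path (Suc n) p"
  shows "0 < last_descent p"
proof (cases p rule: rev_cases)
  case Nil
  then show ?thesis using assms by (simp add: dyck_path_iff)
next
  case (snoc r s)
  then have "s = up_step \<or> s = down_step" using assms by (auto simp: dyck_path_iff)
  moreover have "s \<noteq> up_step"
    using assms snoc nonneg_from_end[of 0 r] by (auto simp: dyck_path_iff nonneg_from_append up_step_def down_step_def)
  ultimately show ?thesis by (simp add: snoc last_descent_snoc)
qed

text \<open>Removing the whole last descent leaves a path of positive height without a trailing down
  step, so it ends with an up step.\<close>

lemma dyck_path_peak_split:
  assumes "dyck_path (Suc n) w" "last_descent w = Suc j"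
  obtains r where "w = r @ up_step # replicate (Suc j) down_step"
proof -
  obtain q where q: "w = q @ replicate (Suc j) down_step" using last_descent_split[of "Suc j" w] assms by auto
  then have "last_descent q = 0" using assms last_descent_append_downs[of q "Suc j"] by simp
  moreover have "set q \<subseteq> {up_step, down_step}" "q \<noteq> []"
    using assms(1) unfolding q dyck_path_append_downs by auto
  ultimately obtain r where "q = r @ [up_step]"
    by (cases q rule: rev_cases) (auto simp: last_descent_snoc split: if_splits)
  then show thesis using that q by simp
qed

lemma num_peaks_eq_count_adj: "num_peaks p = count_adj (\<lambda>s t. s = up_step \<and> t = down_step) p"
  by (simp add: num_peaks_def count_adj_eq_card)

lemma num_peaks_append_downs:
  "num_peaks (r @ replicate j down_step) =
    num_peaks r + (if r \<noteq> [] \<and> 0 < j \<and> last r = up_step then 1 else 0)"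
proof -
  have "num_peaks (replicate j down_step) = 0"
    by (auto simp: num_peaks_def up_neq_down card_eq_0_iff)
  then show ?thesis
    unfolding num_peaks_eq_count_adj count_adj_append by (cases j) auto
qed

lemma num_peaks_insert_peak:
  "num_peaks (r @ up_step # replicate (Suc j) down_step) = Suc (num_peaks r)"
proof -
  have "num_peaks (r @ [up_step]) = num_peaks r"
    unfolding num_peaks_eq_count_adj count_adj_append by (simp add: up_neq_down)
  then show ?thesis using num_peaks_append_downs[of "r @ [up_step]" "Suc j"] by simp
qed

text \<open>A path that begins with an up step and ends with a down step must switch from up to down
  somewhere.\<close>

lemma num_peaks_pos:
  assumes "set p \<subseteq> {up_step, down_step}" "p \<noteq> []" "hd p = up_step" "last p = down_step"
  shows "0 < num_peaks p"
  using assms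
proof (induction p)
  case (Cons s p)
  then obtain t q where "p = t # q" using up_neq_down by (cases p) auto
  then show ?case using Cons by (auto simp: num_peaks_eq_count_adj)
qed simp

definition insert_peak :: "nat \<Rightarrow> (int \<times> int) list \<Rightarrow> (int \<times> int) list" where
  "insert_peak j p = take (length p - j) p @ up_step # replicate (Suc j) down_step"

text \<open>The cut of \<open>Suc (Suc j)\<close> steps takes the up step of the last peak and the
  \<open>Suc j\<close> down steps after it.\<close>

definition remove_peak :: "nat \<Rightarrow> (int \<times> int) list \<Rightarrow> (int \<times> int) list" where
  "remove_peak j p = take (length p - Suc (Suc j)) p @ replicate j down_step"

lemma insert_peak_append:
  "insert_peak j (r @ replicate j down_step) = r @ up_step # replicate (Suc j) down_step"
  by (simp add: insert_peak_def)

lemma remove_peak_append: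
  "remove_peak j (r @ up_step # replicate (Suc j) down_step) = r @ replicate j down_step"
  by (simp add: remove_peak_def)

text \<open>A peak inserted at the top of the last descent replaces the old last peak; further down
  it is additional. Since the label is \<open>j + last_descent r\<close>, the second case is
  \<open>j < label\<close>.\<close>

lemma num_peaks_child:
  assumes u: "dyck_path n (r @ replicate j down_step)"
  shows "num_peaks (r @ up_step # replicate (Suc j) down_step) - 1 =
    num_peaks (r @ replicate j down_step) - 1 + (if 0 < last_descent r then 1 else 0)"
proof -
  have r: "set r \<subseteq> {up_step, down_step}" "snd (sum_list r) = int j" "nonneg_from 0 r"
    using u unfolding dyck_path_append_downs by auto
  show ?thesis
  proof (cases r rule: rev_cases)
    case Nil
    then show ?thesis using num_peaks_insert_peak[of r j] num_peaks_append_downs[of r j]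
      by (simp add: last_descent_def num_peaks_def)
  next
    case (snoc q s)
    show ?thesis
    proof (cases "s = down_step")
      case True
      \<comment> \<open>Here \<open>r\<close> starts with an up step and ends with a down step, so
        it has a peak and the truncated subtraction of 1 is exact.\<close>
      obtain s' q' where "r = s' # q'" using snoc by (metis list.exhaust snoc_eq_iff_butlast)
      moreover from this have "s' = up_step" using r(1,3) nonneg_from_start[of "snd s'" q']
        by (auto simp: down_step_def)
      ultimately have "hd r = up_step" by simp
      moreover have "r \<noteq> []" "last r = down_step" using snoc True by simp_all
      ultimately have "0 < num_peaks r" using num_peaks_pos r(1) by blast
      then show ?thesis
        using num_peaks_insert_peak[of r j] num_peaks_append_downs[of r j] snoc True
        by (simp add: last_descent_snoc up_neq_down)
    next
      case False
      then have "s = up_step" using r(1) snoc by auto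
      \<comment> \<open>After a final up step the height of \<open>r\<close> is positive, so the
        parent has a peak at the end of \<open>r\<close>.\<close>
      moreover have "0 < j"
        using r(2,3) nonneg_from_end[of 0 q] snoc \<open>s = up_step\<close> by (auto simp: nonneg_from_append up_step_def)
      ultimately show ?thesis
        using num_peaks_insert_peak[of r j] num_peaks_append_downs[of r j] snoc False
        by (simp add: last_descent_snoc)
    qed
  qed
qed

text \<open>Truncated subtraction gives the empty path weight 0, the same as its only child, the
  path with one peak.\<close>

interpretation tree_dyck: narayana_tree
  "\<lambda>n. {p. dyck_path n p}" last_descent "\<lambda>p. num_peaks p - 1" insert_peak "[]"
proof (unfold_locales, goal_cases)
  case 1
  then show ?case by (auto simp: dyck_path_iff)
next
  case 2
  then show ?case by (simp add: last_descent_def)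
next
  case 3
  then show ?case by (simp add: num_peaks_def)
next
  case (4 w n)
  then show ?case by (simp add: dyck_path_last_descent_pos)
next
  case (5 j n)
  show ?case
  proof (rule bij_betw_byWitness[where f' = "remove_peak j"])
    have out: "remove_peak j (insert_peak j u) = u \<and> dyck_path (Suc n) (insert_peak j u)
        \<and> last_descent (insert_peak j u) = Suc j" if u: "dyck_path n u" "j \<le> last_descent u" for u
    proof -
      obtain r where r: "u = r @ replicate j down_step" using last_descent_split[OF u(2)] .
      show ?thesis using u(1)
        unfolding r insert_peak_append remove_peak_append last_descent_insert_peak dyck_path_insert_peak by simp
    qed
    then show "\<forall>u\<in>{u \<in> {p. dyck_path n p}. j \<le> last_descent u}. remove_peak j (insert_peak j u) = u"
      and "insert_peak j ` {u \<in> {p. dyck_path n p}. j \<le> last_descent u}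
        \<subseteq> {w \<in> {p. dyck_path (Suc n) p}. last_descent w = Suc j}" by blast+
    have inv: "insert_peak j (remove_peak j w) = w \<and> dyck_path n (remove_peak j w)
        \<and> j \<le> last_descent (remove_peak j w)" if w: "dyck_path (Suc n) w" "last_descent w = Suc j" for w
    proof -
      obtain r where r: "w = r @ up_step # replicate (Suc j) down_step" using dyck_path_peak_split[OF w] .
      show ?thesis using w(1)
        unfolding r remove_peak_append insert_peak_append dyck_path_insert_peak last_descent_append_downs
        by simp
    qed
    then show "\<forall>w\<in>{w \<in> {p. dyck_path (Suc n) p}. last_descent w = Suc j}. insert_peak j (remove_peak j w) = w"
      and "remove_peak j ` {w \<in> {p. dyck_path (Suc n) p}. last_descent w = Suc j}
        \<subseteq> {u \<in> {p. dyck_path n p}. j \<le> last_descent u}" by blast+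
  qed
next
  case (6 u n j)
  obtain r where r: "u = r @ replicate j down_step" using last_descent_split[OF 6(2)] .
  have "dyck_path n u" using 6(1) by simp
  then show ?case
    using num_peaks_child[of n r j] unfolding r insert_peak_append last_descent_append_downs by simp
qed

section \<open>The standard cycle form\<close>

text \<open>The shape of a standard cycle form without reference to a permutation.\<close>

definition decreasing_blocks :: "nat list list \<Rightarrow> bool" where
  "decreasing_blocks cs \<longleftrightarrow>
    (\<forall>c\<in>set cs. c \<noteq> [] \<and> (\<forall>x\<in>set (tl c). hd c < x)) \<and> sorted_wrt (>) (map hd cs)"

text \<open>Each letter of an earlier block is at least the head of that block, which exceeds the
  last head.\<close>

lemma decreasing_blocks_snocE:
  assumes "decreasing_blocks (cs @ [c])"
  obtains m B where "c = m # B" "decreasing_blocks cs" "\<forall>x\<in>set (concat cs). m < x" "\<forall>x\<in>set B. m < x"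
proof -
  have c: "c \<noteq> []" "\<forall>x\<in>set (tl c). hd c < x" and cs: "decreasing_blocks cs"
    and hds: "\<forall>d\<in>set cs. hd c < hd d"
    using assms by (auto simp: decreasing_blocks_def sorted_wrt_append)
  have "hd c < x" if d: "d \<in> set cs" "x \<in> set d" for d x
  proof -
    have "hd d \<le> x" using cs d unfolding decreasing_blocks_def by (cases d) fastforce+
    then show ?thesis using hds d(1) by fastforce
  qed
  then show thesis using that[of "hd c" "tl c"] c cs by auto
qed

text \<open>Each block appended at the end contributes its head, the least letter so far, and
  nothing else.\<close>

lemma num_lr_minima_concat: "decreasing_blocks cs \<Longrightarrow> num_lr_minima (concat cs) = length cs"
proof (induction cs rule: rev_induct)
  case (snoc c cs)
  then show ?case
    by (elim decreasing_blocks_snocE) (simp add: num_lr_minima_append_min)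
qed simp

text \<open>The last block of a word starts at its least letter.\<close>

lemma decreasing_blocks_unique:
  "decreasing_blocks cs \<Longrightarrow> decreasing_blocks ds \<Longrightarrow> concat cs = concat ds \<Longrightarrow> cs = ds"
proof (induction cs arbitrary: ds rule: rev_induct)
  case Nil
  then show ?case by (cases ds) (auto simp: decreasing_blocks_def)
next
  case (snoc c cs)
  obtain m B where c: "c = m # B" "decreasing_blocks cs"
    "\<forall>x\<in>set (concat cs). m < x" "\<forall>x\<in>set B. m < x"
    using decreasing_blocks_snocE[OF snoc.prems(1)] .
  then have "ds \<noteq> []" using snoc.prems(3) by auto
  then obtain ds' d where ds: "ds = ds' @ [d]" using rev_exhaust by blast
  obtain m' B' where d: "d = m' # B'" "decreasing_blocks ds'"
    "\<forall>x\<in>set (concat ds'). m' < x" "\<forall>x\<in>set B'. m' < x"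
    using decreasing_blocks_snocE snoc.prems(2) unfolding ds by blast
  have eq: "concat cs @ m # B = concat ds' @ m' # B'" using snoc.prems(3) c(1) d(1) ds by simp
  \<comment> \<open>Both heads are the least letter of the same word, hence equal; that letter
    occurs only once, so it fixes where the last block begins.\<close>
  have "m \<le> x" if "x \<in> set (concat cs @ m # B)" for x using that c(3,4) by fastforce
  then have "m \<le> m'" unfolding eq by simp
  have "m' \<le> x" if "x \<in> set (concat ds' @ m' # B')" for x using that d(3,4) by fastforce
  then have "m' \<le> m" unfolding eq[symmetric] by simp
  then have "m = m'" using \<open>m \<le> m'\<close> by simp
  then have "concat cs = concat ds' \<and> B = B'"
    using eq c(3,4) append_Cons_eq_iff[of m "concat cs" B "concat ds'" B'] by blast
  then show ?case using snoc.IH[OF c(2) d(2)] c(1) d(1) ds \<open>m = m'\<close> by simp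
qed

section \<open>Cycles of a permutation and its standard cycle form\<close>

lemma orbit_eq_set_support: "permutation p \<Longrightarrow> orbit p x = set (support p x)"
  unfolding support_set orbit_altdef_permutation by auto

lemma orbit_eq_orbit: "permutation p \<Longrightarrow> y \<in> orbit p x \<Longrightarrow> orbit p y = orbit p x"
  by (rule orbit_cyclic_eq3[OF cyclic_on_orbit'])

context
  fixes n :: nat and p :: "nat \<Rightarrow> nat"
  assumes p: "p permutes {1..n}"
begin

lemma permutation_p: "permutation p"
  using p permutation_permutes by blast

lemma orbit_finite_nonempty_self: "finite (orbit p x)" "orbit p x \<noteq> {}" "x \<in> orbit p x"
  using finite_orbit permutation_self_in_orbit[OF permutation_p, of x] by auto

lemma Min_in_orbit: "Min (orbit p x) \<in> orbit p x"
  by (intro Min_in orbit_finite_nonempty_self(1,2))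

lemma cycle_min:
  assumes "m \<in> Min ` cycle_sets n p"
  shows "m \<in> {1..n}" and "Min (orbit p m) = m"
proof -
  obtain x where x: "x \<in> {1..n}" "m = Min (orbit p x)" using assms by (auto simp: cycle_sets_def)
  then have m: "m \<in> orbit p x" using Min_in_orbit by simp
  then show "m \<in> {1..n}" using permutes_orbit_subset[OF p x(1)] by blast
  show "Min (orbit p m) = m" using orbit_eq_orbit[OF permutation_p m] x(2) by simp
qed

lemma hd_support: "hd (support p m) = m" "support p m \<noteq> []"
  using least_power_of_permutation(2)[OF permutation_p, of m] by (simp_all add: upt_conv_Cons)

lemma set_cycle_min_list: "set (rev (sorted_list_of_set (Min ` cycle_sets n p))) = Min ` cycle_sets n p"
  by (simp add: cycle_sets_def)

lemma decreasing_blocks_standard_cycle_form: "decreasing_blocks (standard_cycle_form n p)"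
proof -
  let ?M = "Min ` cycle_sets n p"
  have "hd (support p m) < x" if "m \<in> ?M" "x \<in> set (tl (support p m))" for m x
  proof -
    have "x \<in> set (support p m)" using that(2) hd_support(2) by (meson list.set_sel(2))
    then have "x \<in> orbit p m" using orbit_eq_set_support[OF permutation_p] by simp
    then have "m \<le> x" using cycle_min(2)[OF that(1)] Min_le[OF orbit_finite_nonempty_self(1)] by metis
    moreover have "x \<noteq> m" using cycle_of_permutation[OF permutation_p, of m] that(2) hd_support[of m]
      by (metis distinct.simps(2) list.exhaust_sel)
    ultimately show ?thesis using hd_support(1)[of m] by simp
  qed
  moreover have "map hd (standard_cycle_form n p) = rev (sorted_list_of_set ?M)"
    unfolding standard_cycle_form_def list.map_comp comp_def hd_support by simp
  moreover have "sorted_wrt (>) (rev (sorted_list_of_set ?M))"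
    using strict_sorted_list_of_set[of ?M] by (simp add: sorted_wrt_rev)
  ultimately show ?thesis
    using hd_support(2) set_cycle_min_list by (auto simp: decreasing_blocks_def standard_cycle_form_def)
qed

lemma set_Psi: "set (Psi n p) = {1..n}"
proof -
  have "set (Psi n p) = (\<Union>m\<in>Min ` cycle_sets n p. orbit p m)"
    using set_cycle_min_list by (auto simp: Psi_def standard_cycle_form_def orbit_eq_set_support[OF permutation_p])
  also have "\<dots> = {1..n}"
  proof
    show "(\<Union>m\<in>Min ` cycle_sets n p. orbit p m) \<subseteq> {1..n}"
      using cycle_min(1) permutes_orbit_subset[OF p] by blast
    show "{1..n} \<subseteq> (\<Union>m\<in>Min ` cycle_sets n p. orbit p m)"
    proof
      fix x assume "x \<in> {1..n}"
      then have "Min (orbit p x) \<in> Min ` cycle_sets n p" by (simp add: cycle_sets_def)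
      moreover have "x \<in> orbit p (Min (orbit p x))"
        unfolding orbit_eq_orbit[OF permutation_p Min_in_orbit] by (rule orbit_finite_nonempty_self(3))
      ultimately show "x \<in> (\<Union>m\<in>Min ` cycle_sets n p. orbit p m)" by blast
    qed
  qed
  finally show ?thesis .
qed

lemma distinct_Psi: "distinct (Psi n p)"
  unfolding Psi_def
proof (rule distinct_concat)
  have "distinct (map hd (standard_cycle_form n p))"
    unfolding standard_cycle_form_def list.map_comp comp_def hd_support by simp
  then show "distinct (standard_cycle_form n p)" using distinct_map by blast
  show "distinct ys" if "ys \<in> set (standard_cycle_form n p)" for ys
    using that cycle_of_permutation[OF permutation_p] unfolding standard_cycle_form_def set_map by blast
  show "set ys \<inter> set zs = {}"
    if blocks: "ys \<in> set (standard_cycle_form n p)" "zs \<in> set (standard_cycle_form n p)" "ys \<noteq> zs" for ys zs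
  proof -
    obtain m m' where m: "m \<in> Min ` cycle_sets n p" "m' \<in> Min ` cycle_sets n p"
      "ys = support p m" "zs = support p m'"
      using blocks(1,2) unfolding standard_cycle_form_def set_map set_cycle_min_list by blast
    \<comment> \<open>Cycles sharing a letter coincide as orbits and therefore have the same
      minimum.\<close>
    have "m = m'" if "z \<in> orbit p m" "z \<in> orbit p m'" for z
      using orbit_eq_orbit[OF permutation_p that(1)] orbit_eq_orbit[OF permutation_p that(2)]
        cycle_min(2)[OF m(1)] cycle_min(2)[OF m(2)] by simp
    then show ?thesis using blocks(3) unfolding m(3,4) orbit_eq_set_support[OF permutation_p, symmetric] by blast
  qed
qed

lemma Psi_in_permutations_of_set: "Psi n p \<in> permutations_of_set {1..n}"
  using set_Psi distinct_Psi by blast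

text \<open>There is one block per cycle minimum, and distinct cycles have distinct minima because
  the orbit of its minimum recovers a cycle.\<close>

lemma num_lr_minima_Psi: "num_lr_minima (Psi n p) = num_cycles n p"
proof -
  have "inj_on Min (cycle_sets n p)"
  proof (rule inj_on_inverseI)
    show "orbit p (Min X) = X" if "X \<in> cycle_sets n p" for X
      using that orbit_eq_orbit[OF permutation_p Min_in_orbit] unfolding cycle_sets_def by blast
  qed
  then show ?thesis
    using num_lr_minima_concat[OF decreasing_blocks_standard_cycle_form]
    by (simp add: Psi_def standard_cycle_form_def num_cycles_def card_image)
qed

lemma standard_cycle_form_covers:
  assumes "x \<in> {1..n}"
  obtains c where "c \<in> set (standard_cycle_form n p)" "x \<in> set c"
proof -
  have "x \<in> set (Psi n p)" using assms by (simp only: set_Psi)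
  then have "\<exists>c\<in>set (standard_cycle_form n p). x \<in> set c"
    by (simp only: Psi_def set_concat UN_iff)
  then show thesis using that by (elim bexE)
qed

text \<open>Shows how to read \<open>p\<close> off from its form, the last ingredient for
  injectivity of \<open>Psi\<close>.\<close>

lemma standard_cycle_form_action:
  assumes "c \<in> set (standard_cycle_form n p)" and "x \<in> set c"
  shows "p x = cycle_of_list c x"
proof -
  obtain m where "c = support p m" using assms(1) unfolding standard_cycle_form_def set_map by (elim imageE)
  then show ?thesis using cycle_restrict[OF permutation_p, of x m] assms(2) by (simp only:)
qed

end

text \<open>The word determines its blocks, the blocks determine the permutation on
  \<open>{1..n}\<close>, and elsewhere it is the identity.\<close>

lemma inj_on_Psi: "inj_on (Psi n) {p. p permutes {1..n}}"
proof (rule inj_onI, rule ext)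
  fix p q x
  assume "p \<in> {p. p permutes {1..n}}" "q \<in> {p. p permutes {1..n}}" and eq: "Psi n p = Psi n q"
  then have p: "p permutes {1..n}" and q: "q permutes {1..n}" by auto
  have forms: "standard_cycle_form n p = standard_cycle_form n q"
    using decreasing_blocks_unique decreasing_blocks_standard_cycle_form[OF p]
      decreasing_blocks_standard_cycle_form[OF q] eq unfolding Psi_def by blast
  show "p x = q x"
  proof (cases "x \<in> {1..n}")
    case True
    then obtain c where "c \<in> set (standard_cycle_form n p)" "x \<in> set c"
      using standard_cycle_form_covers[OF p] by blast
    then show ?thesis
      using standard_cycle_form_action[OF p] standard_cycle_form_action[OF q] forms by metis
  next
    case False
    then show ?thesis using p q permutes_not_in by metis
  qed
qed

section \<open>Transfer of counts from permutations to words\<close>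

lemma inj_on_one_line: "inj_on (one_line n) {p. p permutes {1..n}}"
proof (rule inj_onI, rule ext)
  fix p q x
  assume pq: "p \<in> {p. p permutes {1..n}}" "q \<in> {p. p permutes {1..n}}" "one_line n p = one_line n q"
  show "p x = q x"
  proof (cases "x \<in> {1..n}")
    case True
    then show ?thesis using pq(3) by (auto simp: one_line_def less_Suc_eq_le)
  next
    case False
    then show ?thesis using pq(1,2) permutes_not_in by (metis mem_Collect_eq)
  qed
qed

lemma one_line_in_permutations_of_set:
  assumes "p permutes {1..n}"
  shows "one_line n p \<in> permutations_of_set {1..n}"
proof (rule permutations_of_setI)
  have "set (one_line n p) = p ` {1..n}" by (auto simp: one_line_def less_Suc_eq_le)
  then show "set (one_line n p) = {1..n}" using permutes_image[OF assms] by simp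
  show "distinct (one_line n p)"
    using permutes_inj_on[OF assms] by (simp add: one_line_def distinct_map)
qed

lemma num_descents_eq_count_adj: "num_descents n p = count_adj (>) (one_line n p)"
proof -
  \<comment> \<open>Positions start at 1 in the permutation and at 0 in the list, hence the shift by
    \<open>Suc\<close>.\<close>
  have "{i. 1 \<le> i \<and> i < n \<and> p i > p (i + 1)} =
      Suc ` {i. Suc i < length (one_line n p) \<and> one_line n p ! i > one_line n p ! Suc i}"
  proof (intro set_eqI iffI)
    fix i assume i: "i \<in> {i. 1 \<le> i \<and> i < n \<and> p i > p (i + 1)}"
    then obtain j where "i = Suc j" by (cases i) auto
    then show "i \<in> Suc ` {i. Suc i < length (one_line n p) \<and> one_line n p ! i > one_line n p ! Suc i}"
      using i by (auto simp: one_line_def nth_append simp del: upt_Suc)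
  qed (auto simp: one_line_def simp del: upt_Suc)
  then show ?thesis by (simp add: num_descents_def count_adj_eq_card card_image)
qed

text \<open>Permutations and permutation words are equinumerous finite sets, so an injection between
  them is onto. This gives surjectivity of \<open>Psi\<close> without constructing an
  inverse.\<close>

lemma card_permutes_transfer:
  fixes f :: "(nat \<Rightarrow> nat) \<Rightarrow> nat list"
  assumes "inj_on f {p. p permutes {1..n}}"
    and "\<And>p. p permutes {1..n} \<Longrightarrow> f p \<in> permutations_of_set {1..n}"
  shows "card {p. p permutes {1..n} \<and> P (f p)} = card {w \<in> permutations_of_set {1..n}. P w}"
proof -
  have "card (f ` {p. p permutes {1..n}}) = card (permutations_of_set {1..n})"
    unfolding card_image[OF assms(1)] using card_permutations[of "{1..n}" n] by simp
  then have "f ` {p. p permutes {1..n}} = permutations_of_set {1..n}"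
    using assms(2) by (intro card_subset_eq) auto
  then have "{w \<in> permutations_of_set {1..n}. P w} = {w \<in> f ` {p. p permutes {1..n}}. P w}" by (simp only:)
  also have "\<dots> = f ` {p. p permutes {1..n} \<and> P (f p)}" by auto
  finally have "{w \<in> permutations_of_set {1..n}. P w} = f ` {p. p permutes {1..n} \<and> P (f p)}" .
  moreover have "inj_on f {p. p permutes {1..n} \<and> P (f p)}" using assms(1) by (rule inj_on_subset) auto
  ultimately show ?thesis by (simp add: card_image)
qed

section \<open>The five counts\<close>

theorem mainTheorem13:
  fixes n k :: nat
  assumes "n \<ge> 1" and "1 \<le> k" and "k \<le> n"
  shows "card {\<pi>. \<pi> permutes {1..n} \<and> num_cycles n \<pi> = k \<and> cyclically_avoids n \<pi> [1, 3, 2]}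
           = card {\<pi>. \<pi> permutes {1..n} \<and> num_cycles n \<pi> = k \<and> cyclically_avoids n \<pi> [1, 2, 3]}
       \<and> card {\<pi>. \<pi> permutes {1..n} \<and> num_cycles n \<pi> = k \<and> cyclically_avoids n \<pi> [1, 2, 3]}
           = card {p. dyck_path n p \<and> num_peaks p = k}
       \<and> card {p. dyck_path n p \<and> num_peaks p = k}
           = card {\<pi>. \<pi> permutes {1..n} \<and> word_avoids (one_line n \<pi>) [1, 3, 2]
                      \<and> num_descents n \<pi> = k - 1}
       \<and> real (card {\<pi>. \<pi> permutes {1..n} \<and> word_avoids (one_line n \<pi>) [1, 3, 2]
                      \<and> num_descents n \<pi> = k - 1})
           = 1 / real k * real ((n - 1) choose (k - 1)) * real (n choose (k - 1))"
proof -
  obtain N where N: "n = Suc N" using assms(1) by (cases n) auto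
  obtain x where x: "k = Suc x" using assms(2) by (cases k) auto
  \<comment> \<open>Here \<open>x = k - 1\<close> and \<open>y = n - k\<close>; the latter is the
    number of letters that are not left-to-right minima.\<close>
  obtain y where y: "N = x + y" using assms(3) N x by (auto simp: nat_le_iff_add)
  let ?narayana = "real (N choose x) * real (Suc N choose x) / real (Suc x)"
  let ?W = "permutations_of_set {1..n}"
  have w: "distinct w" "length w = n" "w \<noteq> []" if "w \<in> ?W" for w
    using that N permutations_of_setD[OF that] length_finite_permutations_of_set[OF that] by auto

  have Psi: "card {p. p permutes {1..n} \<and> num_cycles n p = k \<and> P (Psi n p)} =
      card {w \<in> ?W. num_lr_minima w = k \<and> P w}" for P
    using card_permutes_transfer[OF inj_on_Psi Psi_in_permutations_of_set,
        of n "\<lambda>w. num_lr_minima w = k \<and> P w"]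
    by (simp add: num_lr_minima_Psi cong: conj_cong)
  have words_132: "real (card {w \<in> ?W. avoids_132 w \<and> count_adj (>) w = x}) = ?narayana"
    using tree_132.card_weight[of N x] unfolding N mem_Collect_eq conj_assoc .

  have "num_lr_minima w = k \<and> avoids_132 w \<longleftrightarrow> avoids_132 w \<and> count_adj (>) w = x" if "w \<in> ?W" for w
    using num_lr_minima_eq_descents[of w] w[OF that] x by auto
  then have lr_132: "{w \<in> ?W. num_lr_minima w = k \<and> avoids_132 w} =
      {w \<in> ?W. avoids_132 w \<and> count_adj (>) w = x}"
    by (simp only: cong: conj_cong)
  have A: "real (card {p. p permutes {1..n} \<and> num_cycles n p = k \<and> cyclically_avoids n p [1, 3, 2]})
      = ?narayana"
    unfolding cyclically_avoids_def word_avoids_132 Psi[of avoids_132] lr_132 by (rule words_132)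

  have "num_lr_minima w = k \<and> avoids_123 w \<longleftrightarrow> avoids_123 w \<and> length w - num_lr_minima w = y"
    if "w \<in> ?W" for w
    using num_lr_minima_le_length[of w] w(2)[OF that] x N y by auto
  then have lr_123: "{w \<in> ?W. num_lr_minima w = k \<and> avoids_123 w} =
      {w \<in> ?W. avoids_123 w \<and> length w - num_lr_minima w = y}"
    by (simp only: cong: conj_cong)
  have "real (card {p. p permutes {1..n} \<and> num_cycles n p = k \<and> cyclically_avoids n p [1, 2, 3]})
      = real (N choose y) * real (Suc N choose y) / real (Suc y)"
    unfolding cyclically_avoids_def word_avoids_123 Psi[of avoids_123] lr_123
    using tree_123.card_weight[of N y] unfolding N mem_Collect_eq conj_assoc .
  \<comment> \<open>Symmetry of the Narayana numbers under exchange of \<open>x\<close> and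
    \<open>y\<close>, which add up to \<open>N\<close>.\<close>
  also have "\<dots> = ?narayana"
  proof -
    have "N choose y = N choose x" using binomial_symmetric[of x N] y by simp
    moreover have "Suc N choose y = Suc N choose Suc x" using binomial_symmetric[of "Suc x" "Suc N"] y by simp
    moreover have "real (Suc x) * real (Suc N choose Suc x) = real (Suc y) * real (Suc N choose x)"
    proof -
      have "Suc x * (Suc N choose Suc x) = Suc y * (Suc N choose x)"
        using binomial_absorption[of x "Suc N"] binomial_absorb_comp[of "Suc N" x] y by simp
      then show ?thesis by (metis of_nat_mult)
    qed
    ultimately show ?thesis by (simp add: divide_simps mult_ac del: binomial_Suc_Suc of_nat_Suc)
  qed
  finally have B: "real (card {p. p permutes {1..n} \<and> num_cycles n p = k \<and> cyclically_avoids n p [1, 2, 3]})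
      = ?narayana" .

  \<comment> \<open>Positivity makes the truncated weight \<open>num_peaks p - 1\<close> equivalent
    to the peak count.\<close>
  have peaks: "0 < num_peaks p" if p: "dyck_path n p" for p
  proof -
    have p': "dyck_path (Suc N) p" using p N by simp
    then obtain j where j: "last_descent p = Suc j"
      using dyck_path_last_descent_pos[OF p'] gr0_implies_Suc by blast
    obtain r where "p = r @ up_step # replicate (Suc j) down_step" using dyck_path_peak_split[OF p' j] .
    then show ?thesis by (simp only: num_peaks_insert_peak zero_less_Suc)
  qed
  have "num_peaks p = k \<longleftrightarrow> num_peaks p - 1 = x" if "dyck_path n p" for p
    using peaks[OF that] x by auto
  then have Dyck: "{p. dyck_path n p \<and> num_peaks p = k} = {p. dyck_path n p \<and> num_peaks p - 1 = x}"
    by (simp only: cong: conj_cong)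
  have C: "real (card {p. dyck_path n p \<and> num_peaks p = k}) = ?narayana"
    unfolding Dyck using tree_dyck.card_weight[of N x] unfolding N mem_Collect_eq .

  have D: "real (card {p. p permutes {1..n} \<and> word_avoids (one_line n p) [1, 3, 2] \<and> num_descents n p = k - 1})
      = ?narayana"
    unfolding word_avoids_132 num_descents_eq_count_adj
    using card_permutes_transfer[OF inj_on_one_line one_line_in_permutations_of_set,
        of n "\<lambda>w. avoids_132 w \<and> count_adj (>) w = x"] words_132 x by simp

  have "?narayana = 1 / real k * real ((n - 1) choose (k - 1)) * real (n choose (k - 1))"
    using N x by simp
  \<comment> \<open>The equalities of cardinalities are checked in the reals, where all four counts
    equal the same number.\<close>
  then show ?thesis using A B C D by (simp only: of_nat_eq_iff[where 'a = real, symmetric] simp_thms)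
qed

end
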